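(* Let $p$ and $q$ be primes such that $p>q>2$ and $q$ divides $p-1$. Let $G=\langle a,b\rangle$ be the non-abelian group of order $pq$ defined by $$a^p=b^q=1,\qquad b^{-1}ab=a^r,$$ where $r\in\{2,3,\ldots,p-1\}$ is some solution to $r^q\equiv 1\pmod p$. Let $\alpha=b$, $\beta=ab$, $\gamma=b^{-1}a^{-1}b^{-1}$. Then $\alpha\beta\gamma=1$; the subgroups $\langle\alpha\rangle,\langle\beta\rangle,\langle\gamma\rangle$ pairwise intersect trivially; and $\langle\alpha,\beta,\gamma\rangle=G$. Thus for each pair of primes $p,q$ such that $q>2$ and $q$ divides $p-1$, there exists a $q$-homogeneous latin bitrade of size $pq$, given by $$\bigl(\{(g\langle\alpha\rangle,g\langle\beta\rangle,g\langle\gamma\rangle)\mid g\in G\},\ \{(g\langle\alpha\rangle,g\langle\beta\rangle,g\alpha^{-1}\langle\gamma\rangle)\mid g\in G\}\bigr).$$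
   Context: Let $A_1,A_2,A_3$ be finite, non-empty, pairwise disjoint sets (of rows, columns and symbols/entries, respectively). A partial latin square is a subset $T\subseteq A_1\times A_2\times A_3$ such that (P1) if $(a_1,a_2,a_3),(b_1,b_2,b_3)\in T$ then either at most one of $a_1=b_1$, $a_2=b_2$, $a_3=b_3$ is true or all three are true; (P2) every element of $A_1\cup A_2\cup A_3$ occurs as a coordinate of some element of $T$. A latin bitrade is a pair $(T^{\circ},T^{\star})$ of partial latin squares $T^{\circ},T^{\star}\subset A_1\times A_2\times A_3$ such that (R1) $T^{\circ}\cap T^{\star}=\emptyset$; (R2) for all $(a_1,a_2,a_3)\in T^{\circ}$ and all $r\ne s$ in $\{1,2,3\}$ there is a unique $(b_1,b_2,b_3)\in T^{\star}$ with $a_r=b_r$ and $a_s=b_s$; (R3) the same as (R2) with $T^{\circ}$ and $T^{\star}$ interchanged. Its size is $|T^{\circ}|=|T^{\star}|$. In the claim, $A_1,A_2,A_3$ are the sets of left cosets in $G$ of $\langle\alpha\rangle,\langle\beta\rangle,\langle\gamma\rangle$. A latin bitrade $(T^{\circ},T^{\star})$ is $k$-homogeneous if each row and each column of $T^{\circ}$ contains precisely $k$ entries and each symbol occurs precisely $k$ times within $T^{\circ}$. *)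

theory Defs
  imports "HOL-Algebra.Generated_Groups" "HOL-Algebra.Left_Coset" "HOL-Number_Theory.Cong"
begin

section \<open>Latin bitrades\<close>

text \<open>The coordinates of a triple are numbered 1, 2, 3 (row, column, symbol).\<close>

definition coord :: "nat \<Rightarrow> 'e \<times> 'e \<times> 'e \<Rightarrow> 'e" where
  "coord i t = (if i = 1 then fst t else if i = 2 then fst (snd t) else snd (snd t))"

definition partial_latin_square ::
    "'e set \<Rightarrow> 'e set \<Rightarrow> 'e set \<Rightarrow> ('e \<times> 'e \<times> 'e) set \<Rightarrow> bool" where
  "partial_latin_square A1 A2 A3 T \<longleftrightarrow>
     finite A1 \<and> finite A2 \<and> finite A3 \<and>
     A1 \<noteq> {} \<and> A2 \<noteq> {} \<and> A3 \<noteq> {} \<and>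
     A1 \<inter> A2 = {} \<and> A1 \<inter> A3 = {} \<and> A2 \<inter> A3 = {} \<and>
     T \<subseteq> A1 \<times> A2 \<times> A3 \<and>
     (\<forall>t\<in>T. \<forall>u\<in>T. card {i \<in> {1, 2, 3}. coord i t = coord i u} \<le> 1 \<or>
                   (\<forall>i\<in>{1, 2, 3}. coord i t = coord i u)) \<and>
     (\<forall>x\<in>A1 \<union> A2 \<union> A3. \<exists>t\<in>T. \<exists>i\<in>{1, 2, 3}. coord i t = x)"

definition latin_bitrade ::
    "'e set \<Rightarrow> 'e set \<Rightarrow> 'e set \<Rightarrow> ('e \<times> 'e \<times> 'e) set \<Rightarrow> ('e \<times> 'e \<times> 'e) set \<Rightarrow> bool" where
  "latin_bitrade A1 A2 A3 T U \<longleftrightarrow>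
     partial_latin_square A1 A2 A3 T \<and> partial_latin_square A1 A2 A3 U \<and>
     T \<inter> U = {} \<and>
     (\<forall>t\<in>T. \<forall>i\<in>{1, 2, 3}. \<forall>j\<in>{1, 2, 3}. i \<noteq> j \<longrightarrow>
        (\<exists>!u. u \<in> U \<and> coord i t = coord i u \<and> coord j t = coord j u)) \<and>
     (\<forall>u\<in>U. \<forall>i\<in>{1, 2, 3}. \<forall>j\<in>{1, 2, 3}. i \<noteq> j \<longrightarrow>
        (\<exists>!t. t \<in> T \<and> coord i u = coord i t \<and> coord j u = coord j t))"

definition homogeneous_latin_bitrade ::
    "nat \<Rightarrow> 'e set \<Rightarrow> 'e set \<Rightarrow> 'e set \<Rightarrow> ('e \<times> 'e \<times> 'e) set \<Rightarrow> ('e \<times> 'e \<times> 'e) set \<Rightarrow> bool" where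
  "homogeneous_latin_bitrade k A1 A2 A3 T U \<longleftrightarrow>
     latin_bitrade A1 A2 A3 T U \<and>
     (\<forall>x\<in>A1. card {t \<in> T. coord 1 t = x} = k) \<and>
     (\<forall>x\<in>A2. card {t \<in> T. coord 2 t = x} = k) \<and>
     (\<forall>x\<in>A3. card {t \<in> T. coord 3 t = x} = k)"


section \<open>The pair of sets of coset triples\<close>

definition coset_trade ::
    "('g, 'm) monoid_scheme \<Rightarrow> 'g \<Rightarrow> 'g \<Rightarrow> 'g \<Rightarrow> ('g set \<times> 'g set \<times> 'g set) set" where
  "coset_trade G x y z =
     {(g <#\<^bsub>G\<^esub> generate G {x}, g <#\<^bsub>G\<^esub> generate G {y}, g <#\<^bsub>G\<^esub> generate G {z})
      | g. g \<in> carrier G}"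

definition coset_mate ::
    "('g, 'm) monoid_scheme \<Rightarrow> 'g \<Rightarrow> 'g \<Rightarrow> 'g \<Rightarrow> ('g set \<times> 'g set \<times> 'g set) set" where
  "coset_mate G x y z =
     {(g <#\<^bsub>G\<^esub> generate G {x}, g <#\<^bsub>G\<^esub> generate G {y},
       (g \<otimes>\<^bsub>G\<^esub> inv\<^bsub>G\<^esub> x) <#\<^bsub>G\<^esub> generate G {z})
      | g. g \<in> carrier G}"


section \<open>Groups given by generators and relations\<close>

text \<open>A word over the alphabet \<open>'x\<close> is a list of signed letters: \<open>(x, True)\<close> stands for
  the letter \<open>x\<close> and \<open>(x, False)\<close> for its formal inverse.\<close>

type_synonym 'x word = "('x \<times> bool) list"

fun word_eval :: "('g, 'm) monoid_scheme \<Rightarrow> ('x \<Rightarrow> 'g) \<Rightarrow> 'x word \<Rightarrow> 'g" where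
  "word_eval G f [] = \<one>\<^bsub>G\<^esub>"
| "word_eval G f ((x, e) # w) = (if e then f x else inv\<^bsub>G\<^esub> f x) \<otimes>\<^bsub>G\<^esub> word_eval G f w"

text \<open>The congruence on words generated by free cancellation and by equating every relator
  in \<open>R\<close> with the empty word; its classes are the elements of the group presented
  by the alphabet \<open>'x\<close> and the relators \<open>R\<close>.\<close>

inductive word_equiv :: "'x word set \<Rightarrow> 'x word \<Rightarrow> 'x word \<Rightarrow> bool" for R where
  equiv_refl: "word_equiv R u u"
| equiv_sym: "word_equiv R u v \<Longrightarrow> word_equiv R v u"
| equiv_trans: "word_equiv R u v \<Longrightarrow> word_equiv R v w \<Longrightarrow> word_equiv R u w"
| equiv_cancel: "word_equiv R (u @ [(x, e), (x, \<not> e)] @ v) (u @ v)"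
| equiv_relator: "s \<in> R \<Longrightarrow> word_equiv R (u @ s @ v) (u @ v)"

text \<open>\<open>G\<close> is the group presented by the alphabet \<open>'x\<close> and the relators \<open>R\<close>, where \<open>f\<close> says
  which element of \<open>G\<close> each letter denotes: evaluation of words induces a bijection
  from the classes of words onto \<open>G\<close>.\<close>

definition presented_group ::
    "('g, 'm) monoid_scheme \<Rightarrow> ('x \<Rightarrow> 'g) \<Rightarrow> 'x word set \<Rightarrow> bool" where
  "presented_group G f R \<longleftrightarrow>
     group G \<and> range f \<subseteq> carrier G \<and> generate G (range f) = carrier G \<and>
     (\<forall>u v. word_eval G f u = word_eval G f v \<longleftrightarrow> word_equiv R u v)"

datatype letter = LA | LB

text \<open>The last relator is that of the relation \<open>b\<^sup>-\<^sup>1 a b = a\<^sup>r\<close>.\<close>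

definition pq_relators :: "nat \<Rightarrow> nat \<Rightarrow> nat \<Rightarrow> letter word set" where
  "pq_relators p q r =
     {replicate p (LA, True),
      replicate q (LB, True),
      [(LB, False), (LA, True), (LB, True)] @ replicate r (LA, False)}"

definition pq_group ::
    "('g, 'm) monoid_scheme \<Rightarrow> 'g \<Rightarrow> 'g \<Rightarrow> nat \<Rightarrow> nat \<Rightarrow> nat \<Rightarrow> bool" where
  "pq_group G a b p q r \<longleftrightarrow> presented_group G (case_letter a b) (pq_relators p q r)"

end

theory Submission
  imports Defs "HOL-Algebra.Multiplicative_Group" "HOL-Number_Theory.Residue_Primitive_Roots"
begin

text \<open>Every word in \<open>a, b\<close> reduces to some \<open>b\<^sup>j a\<^sup>i\<close> with \<open>i < p\<close>, \<open>j < q\<close>, and these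
  normal forms are told apart by an explicit semidirect product on pairs \<open>(i, j)\<close>; hence the
  presented group has order \<open>p q\<close> and is not abelian. An element \<open>b\<^sup>j a\<^sup>i\<close> with
  \<open>r\<^sup>j \<noteq> 1\<close> modulo \<open>p\<close> is conjugate to \<open>b\<^sup>j\<close>, so \<open>\<alpha>\<close>, \<open>\<beta>\<close> and \<open>\<gamma>\<^sup>-\<^sup>1 = \<alpha>\<beta>\<close> have order \<open>q\<close>
  (for the last one \<open>r\<^sup>2 \<noteq> 1\<close> is needed, which holds as \<open>q\<close> is odd). Two subgroups of
  order \<open>q\<close> that meet nontrivially coincide, and then their generators commute; but no two of
  \<open>\<alpha>, \<beta>, \<gamma>\<close> commute because \<open>a\<close> and \<open>b\<close> do not. Finally, trivial pairwise
  intersections say exactly that two coordinates of a coset triple determine \<open>g\<close>, and the relation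
  \<open>\<alpha>\<beta>\<gamma> = 1\<close> provides the exchange between the trade and its mate.\<close>

section \<open>Words\<close>

text \<open>Cancellation and relators already act inside an arbitrary context, so a larger context
  is absorbed into the outer words of each rule.\<close>

lemma word_equiv_context:
  assumes "word_equiv R u v"
  shows "word_equiv R (l @ u @ m) (l @ v @ m)"
  using assms
proof induction
  case (equiv_cancel u x e v)
  then show ?case
    using word_equiv.equiv_cancel[of R "l @ u" x e "v @ m"] by simp
next
  case (equiv_relator s u v)
  then show ?case
    using word_equiv.equiv_relator[of s R "l @ u" "v @ m"] by simp
qed (blast intro: word_equiv.intros)+

lemma word_equiv_append:
  assumes "word_equiv R u u'" "word_equiv R v v'"
  shows "word_equiv R (u @ v) (u' @ v')"
  using word_equiv_context[OF assms(1), of "[]" v] word_equiv_context[OF assms(2), of u' "[]"]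
  by (auto intro: equiv_trans)

text \<open>Letters cancel where the two blocks meet, so the induction removes the innermost pair,
  not an outer one.\<close>

lemma word_equiv_replicate_cancel:
  "word_equiv R (replicate n (x, e) @ replicate n (x, \<not> e)) []"
proof (induction n)
  case (Suc n)
  have "word_equiv R (replicate n (x, e) @ [(x, e), (x, \<not> e)] @ replicate n (x, \<not> e))
      (replicate n (x, e) @ replicate n (x, \<not> e))"
    by (rule equiv_cancel)
  moreover have "replicate n (x, e) @ [(x, e), (x, \<not> e)] @ replicate n (x, \<not> e)
      = replicate (Suc n) (x, e) @ replicate (Suc n) (x, \<not> e)"
    by (metis append.assoc append_Cons append_Nil replicate_Suc replicate_append_same)
  ultimately show ?case
    using Suc equiv_trans by metis
qed (simp add: equiv_refl)

lemma word_equiv_replicate_mod: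
  assumes "word_equiv R (replicate n (x, e)) []"
  shows "word_equiv R (replicate m (x, e)) (replicate (m mod n) (x, e))"
proof -
  have "word_equiv R (replicate (k * n + l) (x, e)) (replicate l (x, e))" for k l
  proof (induction k)
    case (Suc k)
    then show ?case
      using word_equiv_append[OF assms Suc] by (simp add: replicate_add)
  qed (simp add: equiv_refl)
  from this[of "m div n" "m mod n"] show ?thesis by simp
qed

text \<open>The word x^-1 x^(n+1) is reduced in two ways. Trading inverse letters for positive
  powers keeps the normal forms positive.\<close>

lemma word_equiv_inverse_letter:
  assumes "word_equiv R (replicate (Suc n) (x, True)) []"
  shows "word_equiv R [(x, False)] (replicate n (x, True))"
proof -
  have "word_equiv R ([(x, False)] @ replicate (Suc n) (x, True)) ([(x, False)] @ [])"
    by (intro word_equiv_append assms equiv_refl)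
  moreover have "word_equiv R ([(x, False)] @ replicate (Suc n) (x, True)) (replicate n (x, True))"
    using equiv_cancel[of R "[]" x False "replicate n (x, True)"] by simp
  ultimately show ?thesis
    using equiv_sym equiv_trans by (metis append_Nil2)
qed

section \<open>Evaluation of words in a group\<close>

context group
begin

context
  fixes f :: "'x \<Rightarrow> 'a"
  assumes f: "range f \<subseteq> carrier G"
begin

lemma word_eval_closed: "word_eval G f w \<in> carrier G"
proof (induction w)
  case (Cons l w)
  then show ?case using f by (cases l) auto
qed simp

lemma word_eval_append: "word_eval G f (u @ v) = word_eval G f u \<otimes> word_eval G f v"
proof (induction u)
  case (Cons l u)
  moreover have "f (fst l) \<in> carrier G" using f by auto
  ultimately show ?case
    by (cases l) (auto simp: m_assoc word_eval_closed)
qed (simp add: word_eval_closed)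

lemma word_eval_replicate:
  "word_eval G f (replicate n (x, e)) = (if e then f x else inv f x) [^] n"
proof (induction n)
  case (Suc n)
  have "f x \<in> carrier G" using f by auto
  then show ?case using Suc by (simp flip: nat_pow_Suc2)
qed simp

text \<open>Each elementary move preserves the value once the relators evaluate to the unit; this is
  the easy half of the word problem.\<close>

lemma word_equiv_sound:
  assumes "word_equiv R u v" and "\<And>s. s \<in> R \<Longrightarrow> word_eval G f s = \<one>"
  shows "word_eval G f u = word_eval G f v"
  using assms(1)
proof induction
  case (equiv_cancel u x e v)
  have "f x \<in> carrier G" using f by auto
  then have "word_eval G f [(x, e), (x, \<not> e)] = \<one>" by auto
  then show ?case by (simp only: word_eval_append) (simp add: word_eval_closed)
qed (simp_all add: assms(2) word_eval_append word_eval_closed)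

text \<open>The rules of \<open>generate\<close> mirror words: the unit is the empty word,
  generators and their inverses are one-letter words, products are concatenations.\<close>

lemma generate_eq_range_word_eval: "generate G (range f) = range (word_eval G f)"
proof
  show "generate G (range f) \<subseteq> range (word_eval G f)"
  proof
    fix g assume "g \<in> generate G (range f)"
    then show "g \<in> range (word_eval G f)"
    proof induction
      case one
      show ?case by (rule range_eqI[of _ _ "[]"]) simp
    next
      case (incl h)
      then obtain x where "h = f x" "f x \<in> carrier G" using f by auto
      then show ?case by (intro range_eqI[of _ _ "[(x, True)]"]) auto
    next
      case (inv h)
      then obtain x where "h = f x" "f x \<in> carrier G" using f by auto
      then show ?case by (intro range_eqI[of _ _ "[(x, False)]"]) auto
    next
      case (eng h1 h2)
      then obtain u v where "h1 = word_eval G f u" "h2 = word_eval G f v" by auto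
      then show ?case by (metis rangeI word_eval_append)
    qed
  qed
  have "word_eval G f w \<in> generate G (range f)" for w
  proof (induction w)
    case (Cons l w)
    then show ?case by (cases l) (auto intro: generate.intros)
  qed (simp add: generate.one)
  then show "range (word_eval G f) \<subseteq> generate G (range f)" by auto
qed

end

end


section \<open>Normal forms\<close>

text \<open>The block of \<open>LB\<close> comes first because the relation reads a b = b a^r:
  moving a to the right past b multiplies its exponent by r, and no inverse of r modulo p occurs.
  The pair nevertheless lists the exponent of a first.\<close>

definition normal_form :: "nat \<times> nat \<Rightarrow> letter word" where
  "normal_form = (\<lambda>(i, j). replicate j (LB, True) @ replicate i (LA, True))"

context
  fixes p q r :: nat
begin

abbreviation pq_equiv (infix "\<approx>" 50) where
  "u \<approx> v \<equiv> word_equiv (pq_relators p q r) u v"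

lemma pq_equiv_LA: "replicate p (LA, True) \<approx> []"
  and pq_equiv_LB: "replicate q (LB, True) \<approx> []"
  using equiv_relator[of _ "pq_relators p q r" "[]" "[]"] by (auto simp: pq_relators_def)

lemma pq_equiv_swap: "[(LA, True)] @ [(LB, True)] \<approx> [(LB, True)] @ replicate r (LA, True)"
proof -
  let ?s = "[(LB, False), (LA, True), (LB, True)] @ replicate r (LA, False)"
  \<comment> \<open>The relator sits between b and a^r. Deleting it leaves b a^r; cancelling b b^-1
    at the front and a^-r a^r at the end leaves a b.\<close>
  have "[(LB, True)] @ ?s @ replicate r (LA, True) \<approx> [(LB, True)] @ replicate r (LA, True)"
    by (rule equiv_relator) (simp add: pq_relators_def)
  moreover have "[(LB, True)] @ ?s @ replicate r (LA, True) \<approx>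
      [(LA, True), (LB, True)] @ replicate r (LA, False) @ replicate r (LA, True)"
    using equiv_cancel[of _ "[]" LB True] by simp
  moreover have "[(LA, True), (LB, True)] @ replicate r (LA, False) @ replicate r (LA, True)
      \<approx> [(LA, True), (LB, True)] @ []"
    by (rule word_equiv_append[OF equiv_refl])
      (use word_equiv_replicate_cancel[of _ r LA False] in simp)
  ultimately show ?thesis
    by simp (blast intro: equiv_trans equiv_sym)
qed

lemma pq_equiv_swap_power:
  "replicate i (LA, True) @ [(LB, True)] \<approx> [(LB, True)] @ replicate (i * r) (LA, True)"
proof (induction i)
  case (Suc i)
  have "[(LA, True)] @ replicate i (LA, True) @ [(LB, True)]
      \<approx> [(LA, True)] @ [(LB, True)] @ replicate (i * r) (LA, True)"
    by (rule word_equiv_append[OF equiv_refl Suc])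
  moreover have "([(LA, True)] @ [(LB, True)]) @ replicate (i * r) (LA, True)
      \<approx> ([(LB, True)] @ replicate r (LA, True)) @ replicate (i * r) (LA, True)"
    by (rule word_equiv_append[OF pq_equiv_swap equiv_refl])
  ultimately show ?case
    by (simp add: replicate_add) (blast intro: equiv_trans)
qed (simp add: equiv_refl)

lemma pq_equiv_swap_powers:
  "replicate i (LA, True) @ replicate j (LB, True)
    \<approx> replicate j (LB, True) @ replicate (i * r ^ j) (LA, True)"
\<comment> \<open>Past the first \<open>LB\<close> the exponent of \<open>LA\<close> has become i *
  r, so the hypothesis is needed for that value.\<close>
proof (induction j arbitrary: i)
  case (Suc j)
  have "(replicate i (LA, True) @ [(LB, True)]) @ replicate j (LB, True)
      \<approx> ([(LB, True)] @ replicate (i * r) (LA, True)) @ replicate j (LB, True)"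
    by (rule word_equiv_append[OF pq_equiv_swap_power equiv_refl])
  moreover have "[(LB, True)] @ (replicate (i * r) (LA, True) @ replicate j (LB, True))
      \<approx> [(LB, True)] @ replicate j (LB, True) @ replicate (i * r * r ^ j) (LA, True)"
    by (rule word_equiv_append[OF equiv_refl Suc])
  ultimately show ?case
    by (simp add: mult.assoc) (blast intro: equiv_trans)
qed (simp add: equiv_refl)

text \<open>This bounds the number of classes by p q. A word is absorbed from the right, letter by
  letter: a power of b joins the front block, a power of a crosses it.\<close>

lemma pq_equiv_normal_form:
  assumes "p > 0" "q > 0"
  shows "\<exists>x \<in> {..<p} \<times> {..<q}. w \<approx> normal_form x"
proof -
  have "\<exists>i j. w \<approx> normal_form (i, j)"
  proof (induction w)
    case Nil
    then show ?case by (intro exI[of _ 0]) (simp add: normal_form_def equiv_refl)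
  next
    case (Cons l w)
    then obtain i j where ij: "w \<approx> normal_form (i, j)" by blast
    obtain x e where l: "l = (x, e)" by fastforce
    \<comment> \<open>An inverse letter becomes the power p - 1 of a or q - 1 of b.\<close>
    have "\<exists>n. [l] \<approx> replicate n (x, True)"
    proof (cases e)
      case True
      then show ?thesis using l by (intro exI[of _ 1]) (simp add: equiv_refl)
    next
      case False
      then show ?thesis
        using l assms word_equiv_inverse_letter[of "pq_relators p q r" "p - 1" LA]
          word_equiv_inverse_letter[of "pq_relators p q r" "q - 1" LB] pq_equiv_LA pq_equiv_LB
        by (cases x) auto
    qed
    then obtain n where n: "[l] \<approx> replicate n (x, True)" by blast
    have lw: "l # w \<approx> replicate n (x, True) @ normal_form (i, j)"
      using word_equiv_append[OF n ij] by simp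
    show ?case
    proof (cases x)
      case LA
      have "(replicate n (LA, True) @ replicate j (LB, True)) @ replicate i (LA, True)
          \<approx> (replicate j (LB, True) @ replicate (n * r ^ j) (LA, True)) @ replicate i (LA, True)"
        by (rule word_equiv_append[OF pq_equiv_swap_powers equiv_refl])
      then have "replicate n (x, True) @ normal_form (i, j) \<approx> normal_form (n * r ^ j + i, j)"
        by (simp add: normal_form_def LA replicate_add)
      then show ?thesis using lw equiv_trans by blast
    next
      case LB
      then have "replicate n (x, True) @ normal_form (i, j) = normal_form (i, n + j)"
        by (simp add: normal_form_def replicate_add)
      then show ?thesis using lw by metis
    qed
  qed
  then obtain i j where ij: "w \<approx> normal_form (i, j)" by blast
  have "normal_form (i, j) \<approx> normal_form (i mod p, j mod q)"
    unfolding normal_form_def prod.case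
    by (intro word_equiv_append word_equiv_replicate_mod pq_equiv_LA pq_equiv_LB)
  then show ?thesis
    using ij assms by (intro bexI[of _ "(i mod p, j mod q)"]) (auto intro: equiv_trans)
qed

end


section \<open>A model of the presentation\<close>

text \<open>The pair \<open>(i, j)\<close> stands for \<open>b\<^sup>j a\<^sup>i\<close>.\<close>

definition pq_model :: "nat \<Rightarrow> nat \<Rightarrow> nat \<Rightarrow> (nat \<times> nat) monoid" where
  "pq_model p q r =
    \<lparr>carrier = {..<p} \<times> {..<q},
     monoid.mult = (\<lambda>(i, j) (k, l). ((i * r ^ l + k) mod p, (j + l) mod q)),
     monoid.one = (0, 0)\<rparr>"

text \<open>The congruence makes r^j depend on j modulo q alone; associativity and inverses in the
  model rest on this.\<close>

locale pq_params =
  fixes p q r :: nat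
  assumes p: "p > 1" and q: "q > 1" and r: "[r ^ q = 1] (mod p)"
begin

abbreviation M where "M \<equiv> pq_model p q r"

lemma pow_r_mod: "[r ^ (n mod q) = r ^ n] (mod p)"
proof -
  have "[(r ^ q) ^ (n div q) * r ^ (n mod q) = 1 ^ (n div q) * r ^ (n mod q)] (mod p)"
    by (intro cong_mult cong_pow r cong_refl)
  then show ?thesis
    by (simp add: cong_sym_eq flip: power_mult power_add)
qed

lemma group_model: "group M"
proof (rule groupI)
  fix x y z assume "x \<in> carrier M" "y \<in> carrier M" "z \<in> carrier M"
  obtain i j k l m n where [simp]: "x = (i, j)" "y = (k, l)" "z = (m, n)"
    by (metis surj_pair)
  \<comment> \<open>Both bracketings give a the exponent i r^(l+n) + k r^n + m; they differ only in
    where reductions modulo p and q take place.\<close>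
  have "[((i * r ^ l + k) mod p) * r ^ n + m = (i * r ^ l + k) * r ^ n + m] (mod p)"
    by (intro cong_add cong_mult cong_refl) simp
  also have "(i * r ^ l + k) * r ^ n + m = i * r ^ (l + n) + (k * r ^ n + m)"
    by (simp add: algebra_simps power_add)
  also have "[\<dots> = i * r ^ ((l + n) mod q) + (k * r ^ n + m) mod p] (mod p)"
    by (intro cong_add cong_mult cong_refl cong_sym[OF pow_r_mod]) (simp add: cong_def)
  finally show "x \<otimes>\<^bsub>M\<^esub> y \<otimes>\<^bsub>M\<^esub> z = x \<otimes>\<^bsub>M\<^esub> (y \<otimes>\<^bsub>M\<^esub> z)"
    by (simp add: pq_model_def cong_def add.assoc mod_simps)
next
  fix x assume "x \<in> carrier M"
  then obtain i j where x: "x = (i, j)" "i < p" "j < q" by (auto simp: pq_model_def)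
  \<comment> \<open>This is the left inverse a^-i b^-j = b^-j a^(-i r^-j), with p - 1 in the role of
    -1 and r^(q - j) in that of r^-j. The last \<open>mod q\<close> takes care of j = 0.\<close>
  let ?k = "((p - 1) * i * r ^ (q - j)) mod p" and ?l = "(q - j) mod q"
  have "[?k * r ^ j + i = (p - 1) * i * r ^ (q - j) * r ^ j + i] (mod p)"
    by (intro cong_add cong_mult cong_refl) simp
  also have "(p - 1) * i * r ^ (q - j) * r ^ j = (p - 1) * i * r ^ q"
    using x by (simp flip: power_add)
  also have "[\<dots> + i = (p - 1) * i * 1 + i] (mod p)"
    by (intro cong_add cong_mult cong_refl r)
  also have "(p - 1) * i * 1 + i = p * i"
    using p by (cases p) simp_all
  finally have "(?k * r ^ j + i) mod p = 0"
    by (simp add: cong_def)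
  moreover have "(?l + j) mod q = 0"
    using x by (simp add: mod_simps)
  ultimately have "(?k, ?l) \<otimes>\<^bsub>M\<^esub> x = \<one>\<^bsub>M\<^esub>"
    by (simp add: pq_model_def x)
  moreover have "(?k, ?l) \<in> carrier M"
    using p q by (simp add: pq_model_def)
  ultimately show "\<exists>y\<in>carrier M. y \<otimes>\<^bsub>M\<^esub> x = \<one>\<^bsub>M\<^esub>" by blast
qed (use p q in \<open>auto simp: pq_model_def\<close>)

sublocale M: group M
  by (rule group_model)

section \<open>The word problem solved in the model\<close>

abbreviation letter_model where "letter_model \<equiv> case_letter (1, 0) (0, 1)"

lemma range_letter_model: "range letter_model \<subseteq> carrier M"
  using p q by (auto simp: pq_model_def split: letter.splits)

lemma pow_LA_model: "(1, 0) [^]\<^bsub>M\<^esub> (n::nat) = (n mod p, 0)"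
  using p q by (induction n) (auto simp: pq_model_def mod_simps)

lemma pow_LB_model: "(0, 1) [^]\<^bsub>M\<^esub> (n::nat) = (0, n mod q)"
  using p q by (induction n) (auto simp: pq_model_def mod_simps)

lemma eval_normal_form_model:
  assumes "x \<in> {..<p} \<times> {..<q}"
  shows "word_eval M letter_model (normal_form x) = x"
proof -
  obtain i j where x: "x = (i, j)" "i < p" "j < q" using assms by auto
  then have "word_eval M letter_model (normal_form x) = (0, j) \<otimes>\<^bsub>M\<^esub> (i, 0)"
    using pow_LA_model[of i] pow_LB_model[of j]
    by (simp add: normal_form_def M.word_eval_append[OF range_letter_model]
        M.word_eval_replicate[OF range_letter_model] del: One_nat_def)
  then show ?thesis using x by (simp add: pq_model_def)
qed

lemma relators_model:
  assumes "s \<in> pq_relators p q r"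
  shows "word_eval M letter_model s = \<one>\<^bsub>M\<^esub>"
proof -
  note ev = M.word_eval_append[OF range_letter_model] M.word_eval_replicate[OF range_letter_model]
  have c: "(1, 0) \<in> carrier M" "(0, 1) \<in> carrier M"
    using p q by (auto simp: pq_model_def)
  have swap: "(1, 0) \<otimes>\<^bsub>M\<^esub> (0, 1) = (0, 1) \<otimes>\<^bsub>M\<^esub> ((1, 0) [^]\<^bsub>M\<^esub> r)"
    unfolding pow_LA_model using p q by (simp add: pq_model_def)
  \<comment> \<open>Only the third relator needs a computation: it groups as b^-1 (a b) a^-r, and
    \<open>swap\<close> turns the middle into b a^r.\<close>
  have "word_eval M letter_model ([(LB, False), (LA, True), (LB, True)] @ replicate r (LA, False))
      = inv\<^bsub>M\<^esub> (0, 1) \<otimes>\<^bsub>M\<^esub> ((1, 0) \<otimes>\<^bsub>M\<^esub> (0, 1)) \<otimes>\<^bsub>M\<^esub> inv\<^bsub>M\<^esub> ((1, 0) [^]\<^bsub>M\<^esub> r)"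
    using c by (simp only: ev) (simp add: M.m_assoc M.nat_pow_inv)
  also have "\<dots> = \<one>\<^bsub>M\<^esub>"
    unfolding swap using c by (simp flip: M.m_assoc)
  finally have "word_eval M letter_model
      ([(LB, False), (LA, True), (LB, True)] @ replicate r (LA, False)) = \<one>\<^bsub>M\<^esub>" .
  moreover have "\<one>\<^bsub>M\<^esub> = (0, 0)" by (simp add: pq_model_def)
  ultimately show ?thesis
    using assms pow_LA_model[of p] pow_LB_model[of q] unfolding pq_relators_def
    by (auto simp only: ev letter.case if_True insert_iff empty_iff mod_self)
qed

text \<open>Both words are brought to normal form; evaluation reads off the exponents, so equal
  values force equal normal forms.\<close>

lemma pq_equiv_iff_model:
  "word_eval M letter_model u = word_eval M letter_model v \<longleftrightarrow> word_equiv (pq_relators p q r) u v"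
proof
  assume *: "word_eval M letter_model u = word_eval M letter_model v"
  have "p > 0" "q > 0" using p q by auto
  note nf = pq_equiv_normal_form[OF this, where r = r]
  obtain x where x: "x \<in> {..<p} \<times> {..<q}" "word_equiv (pq_relators p q r) u (normal_form x)"
    using nf by blast
  obtain y where y: "y \<in> {..<p} \<times> {..<q}" "word_equiv (pq_relators p q r) v (normal_form y)"
    using nf by blast
  have "x = word_eval M letter_model u"
    using M.word_equiv_sound[OF range_letter_model x(2) relators_model]
      eval_normal_form_model[OF x(1)] by simp
  moreover have "y = word_eval M letter_model v"
    using M.word_equiv_sound[OF range_letter_model y(2) relators_model]
      eval_normal_form_model[OF y(1)] by simp
  ultimately have "x = y" using * by simp
  then show "word_equiv (pq_relators p q r) u v"
    using x y by (blast intro: equiv_sym equiv_trans)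
next
  assume "word_equiv (pq_relators p q r) u v"
  then show "word_eval M letter_model u = word_eval M letter_model v"
    by (rule M.word_equiv_sound[OF range_letter_model _ relators_model])
qed

text \<open>Provides the concrete group for the existence claim.\<close>

lemma pq_group_model: "pq_group M (1, 0) (0, 1) p q r"
proof -
  have "generate M (range letter_model) = carrier M"
  proof
    show "generate M (range letter_model) \<subseteq> carrier M"
      using M.generate_incl range_letter_model by blast
    have "x \<in> generate M (range letter_model)" if "x \<in> carrier M" for x
    proof -
      have "x \<in> {..<p} \<times> {..<q}" using that by (simp add: pq_model_def)
      then show ?thesis
        unfolding M.generate_eq_range_word_eval[OF range_letter_model]
        by (metis eval_normal_form_model rangeI)
    qed
    then show "carrier M \<subseteq> generate M (range letter_model)" by blast
  qed
  then show ?thesis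
    using group_model range_letter_model pq_equiv_iff_model
    by (simp add: pq_group_def presented_group_def del: One_nat_def)
qed

text \<open>Equality in G is the word congruence, and the congruence is equality in the model.
  Relations therefore come from derivations of words, distinctness of elements from the
  model.\<close>

lemma pq_group_structure:
  fixes G (structure)
  assumes "pq_group G a b p q r"
  shows "group G" "a \<in> carrier G" "b \<in> carrier G" "generate G {a, b} = carrier G"
    "a [^] p = \<one>" "b [^] q = \<one>" "a \<otimes> b = b \<otimes> a [^] r" "order G = p * q"
    "[r \<noteq> 1] (mod p) \<Longrightarrow> a \<otimes> b \<noteq> b \<otimes> a"
proof -
  let ?f = "case_letter a b"
  have G: "group G" and f: "range ?f \<subseteq> carrier G"
    and gen: "generate G (range ?f) = carrier G"
    and eq: "word_eval G ?f u = word_eval G ?f v \<longleftrightarrow> word_equiv (pq_relators p q r) u v" for u v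
    using assms by (auto simp: pq_group_def presented_group_def)
  interpret group G by (rule G)
  show "group G" by (rule G)
  have range_f: "range ?f = {a, b}"
    by (auto simp: image_iff split: letter.split)
  show a: "a \<in> carrier G" and b: "b \<in> carrier G" using f range_f by auto
  show "generate G {a, b} = carrier G" using gen range_f by simp
  note ev = word_eval_append[OF f] word_eval_replicate[OF f]
  show "a [^] p = \<one>" "b [^] q = \<one>"
    using eq[of "replicate p (LA, True)" "[]"] eq[of "replicate q (LB, True)" "[]"]
      pq_equiv_LA pq_equiv_LB by (simp_all add: ev)
  have "word_eval G ?f ([(LA, True)] @ [(LB, True)])
      = word_eval G ?f ([(LB, True)] @ replicate r (LA, True))"
    unfolding eq by (rule pq_equiv_swap)
  then show "a \<otimes> b = b \<otimes> a [^] r"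
    using a b by (simp only: ev) simp
  \<comment> \<open>Normal forms parametrise G: injectivity is inherited from the model,
    surjectivity from the reduction of words.\<close>
  have "inj_on (\<lambda>x. word_eval G ?f (normal_form x)) ({..<p} \<times> {..<q})"
  proof (rule inj_onI)
    fix x y assume xy: "x \<in> {..<p} \<times> {..<q}" "y \<in> {..<p} \<times> {..<q}"
      and "word_eval G ?f (normal_form x) = word_eval G ?f (normal_form y)"
    then have "word_eval M letter_model (normal_form x) = word_eval M letter_model (normal_form y)"
      unfolding eq pq_equiv_iff_model by simp
    then show "x = y" unfolding eval_normal_form_model[OF xy(1)] eval_normal_form_model[OF xy(2)] .
  qed
  moreover have "(\<lambda>x. word_eval G ?f (normal_form x)) ` ({..<p} \<times> {..<q}) = carrier G"
  proof -
    have "g \<in> (\<lambda>x. word_eval G ?f (normal_form x)) ` ({..<p} \<times> {..<q})" if g: "g \<in> carrier G" for g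
    proof -
      obtain w where w: "g = word_eval G ?f w"
        using g gen generate_eq_range_word_eval[OF f] by auto
      obtain x where x: "x \<in> {..<p} \<times> {..<q}" "word_equiv (pq_relators p q r) w (normal_form x)"
        using pq_equiv_normal_form[of p q r w] p q by auto
      have "g = word_eval G ?f (normal_form x)" using w iffD2[OF eq x(2)] by simp
      then show ?thesis using x(1) by (rule image_eqI)
    qed
    then show ?thesis using word_eval_closed[OF f] by blast
  qed
  ultimately show "order G = p * q"
    unfolding order_def using card_image by fastforce
  assume r1: "[r \<noteq> 1] (mod p)"
  show "a \<otimes> b \<noteq> b \<otimes> a"
  proof
    assume "a \<otimes> b = b \<otimes> a"
    then have "word_eval G ?f [(LA, True), (LB, True)] = word_eval G ?f [(LB, True), (LA, True)]"
      using a b by simp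
    \<comment> \<open>In the model a b is (r mod p, 1), whereas b a is (1, 1).\<close>
    then have "word_eval M letter_model [(LA, True), (LB, True)]
        = word_eval M letter_model [(LB, True), (LA, True)]"
      unfolding eq pq_equiv_iff_model .
    then show False
      using r1 p q by (simp add: pq_model_def cong_def)
  qed
qed

end


section \<open>Bitrades from triples of group elements\<close>

lemma (in group) l_coset_eq_iff:
  assumes "subgroup H G" "g \<in> carrier G" "h \<in> carrier G"
  shows "g <# H = h <# H \<longleftrightarrow> inv g \<otimes> h \<in> H"
proof
  assume "g <# H = h <# H"
  then have "h \<in> g <# H" using lcos_self[OF assms(3,1)] by simp
  then show "inv g \<otimes> h \<in> H"
    by (rule subgroup.lcos_module_imp[OF assms(1) group_axioms assms(2)])
next
  assume "inv g \<otimes> h \<in> H"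
  then have "h \<in> g <# H"
    by (rule subgroup.lcos_module_rev[OF assms(1) group_axioms assms(2,3)])
  then show "g <# H = h <# H"
    by (rule l_repr_independence[OF _ assms(2,1)])
qed

text \<open>Once g represents the coset on both sides, translation by \<open>inv g\<close> recovers
  the subgroup. This is what keeps rows, columns and symbols disjoint.\<close>

lemma (in group) l_coset_eq_imp_subgroup_eq:
  assumes "subgroup H G" "subgroup K G" "g \<in> carrier G" "h \<in> carrier G" "g <# H = h <# K"
  shows "H = K"
proof -
  have "g \<in> h <# K" using lcos_self[OF assms(3,1)] assms(5) by simp
  then have "g <# H = g <# K"
    using l_repr_independence[OF _ assms(4,2)] assms(5) by simp
  then have "inv g <# (g <# H) = inv g <# (g <# K)" by simp
  then show ?thesis
    using assms(1-3) by (simp add: lcos_m_assoc lcos_mult_one subgroup.subset)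
qed

lemma (in group) inv_mult_eq_one:
  assumes "g \<in> carrier G" "h \<in> carrier G" "inv g \<otimes> h = \<one>"
  shows "g = h"
  using assms inv_equality[OF assms(3)] by (metis inv_closed inv_inv)

lemma (in group) lcosets_disjoint:
  assumes "subgroup H G" "subgroup K G" "H \<noteq> K"
  shows "(lcosets H) \<inter> (lcosets K) = {}"
  using assms l_coset_eq_imp_subgroup_eq by (fastforce simp: LCOSETS_def)

lemma (in group) lcosets_nonempty: "lcosets H \<noteq> {}"
  by (auto simp: LCOSETS_def)

section \<open>Criteria for partial latin squares and bitrades\<close>

lemma partial_latin_squareI:
  assumes "finite A1" "finite A2" "finite A3" "A1 \<noteq> {}" "A2 \<noteq> {}" "A3 \<noteq> {}"
    and "A1 \<inter> A2 = {}" "A1 \<inter> A3 = {}" "A2 \<inter> A3 = {}" "T \<subseteq> A1 \<times> A2 \<times> A3"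
    and determined: "\<And>t u i j. \<lbrakk>t \<in> T; u \<in> T; i \<in> {1, 2, 3}; j \<in> {1, 2, 3}; i \<noteq> j;
      coord i t = coord i u; coord j t = coord j u\<rbrakk> \<Longrightarrow> t = u"
    and "\<And>x. x \<in> A1 \<union> A2 \<union> A3 \<Longrightarrow> \<exists>t\<in>T. \<exists>i\<in>{1, 2, 3}. coord i t = x"
  shows "partial_latin_square A1 A2 A3 T"
proof -
  have P1: "card {i \<in> {1, 2, 3}. coord i t = coord i u} \<le> 1 \<or>
    (\<forall>i\<in>{1, 2, 3}. coord i t = coord i u)" if tu: "t \<in> T" "u \<in> T" for t u
  proof (cases "t = u")
    case False
    define I where "I = {i \<in> {1, 2, 3}. coord i t = coord i u}"
    have "i = j" if "i \<in> I" "j \<in> I" for i j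
    proof (rule ccontr)
      assume "i \<noteq> j"
      moreover have "i \<in> {1, 2, 3}" "j \<in> {1, 2, 3}" "coord i t = coord i u" "coord j t = coord j u"
        using that unfolding I_def by blast+
      ultimately show False using determined[OF tu] False by blast
    qed
    moreover have "finite I" by (simp add: I_def)
    ultimately have "card I \<le> Suc 0"
      using card_le_Suc0_iff_eq by blast
    then show ?thesis by (simp add: I_def)
  qed simp
  show ?thesis
    unfolding partial_latin_square_def
    by (intro conjI ballI assms(1-10,12) P1)
qed

text \<open>Uniqueness of a partner follows from the assumptions \<open>T\<close> and
  \<open>U\<close>, since two partners of one triple agree with each other in positions i and j.
  Only existence remains to be supplied.\<close>

lemma latin_bitradeI:
  assumes "partial_latin_square A1 A2 A3 T" "partial_latin_square A1 A2 A3 U" "T \<inter> U = {}"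
    and T: "\<And>t u i j. \<lbrakk>t \<in> T; u \<in> T; i \<in> {1, 2, 3}; j \<in> {1, 2, 3}; i \<noteq> j;
      coord i t = coord i u; coord j t = coord j u\<rbrakk> \<Longrightarrow> t = u"
    and U: "\<And>t u i j. \<lbrakk>t \<in> U; u \<in> U; i \<in> {1, 2, 3}; j \<in> {1, 2, 3}; i \<noteq> j;
      coord i t = coord i u; coord j t = coord j u\<rbrakk> \<Longrightarrow> t = u"
    and TU: "\<And>t i j. \<lbrakk>t \<in> T; i \<in> {1, 2, 3}; j \<in> {1, 2, 3}; i \<noteq> j\<rbrakk>
      \<Longrightarrow> \<exists>u\<in>U. coord i t = coord i u \<and> coord j t = coord j u"
    and UT: "\<And>u i j. \<lbrakk>u \<in> U; i \<in> {1, 2, 3}; j \<in> {1, 2, 3}; i \<noteq> j\<rbrakk>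
      \<Longrightarrow> \<exists>t\<in>T. coord i u = coord i t \<and> coord j u = coord j t"
  shows "latin_bitrade A1 A2 A3 T U"
  unfolding latin_bitrade_def
proof (intro conjI ballI impI assms(1-3))
  fix t i j assume *: "t \<in> T" "i \<in> {1, 2, 3}" "j \<in> {1, 2, 3}" "i \<noteq> (j::nat)"
  obtain u where u: "u \<in> U" "coord i t = coord i u" "coord j t = coord j u"
    using TU[OF *] by blast
  show "\<exists>!u. u \<in> U \<and> coord i t = coord i u \<and> coord j t = coord j u"
  proof (rule ex1I[of _ u])
    fix v assume "v \<in> U \<and> coord i t = coord i v \<and> coord j t = coord j v"
    then show "v = u" using u U[OF _ _ *(2-4), of v u] by simp
  qed (use u in simp)
next
  fix u i j assume *: "u \<in> U" "i \<in> {1, 2, 3}" "j \<in> {1, 2, 3}" "i \<noteq> (j::nat)"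
  obtain t where t: "t \<in> T" "coord i u = coord i t" "coord j u = coord j t"
    using UT[OF *] by blast
  show "\<exists>!t. t \<in> T \<and> coord i u = coord i t \<and> coord j u = coord j t"
  proof (rule ex1I[of _ t])
    fix v assume "v \<in> T \<and> coord i u = coord i v \<and> coord j u = coord j v"
    then show "v = t" using t T[OF _ _ *(2-4), of v t] by simp
  qed (use t in simp)
qed

text \<open>The variant with \<open>Suc 0\<close> is present because the simplifier rewrites the
  natural number \<open>1\<close> to it.\<close>

lemma coord_simps [simp]: "coord 1 (u, v, w) = u" "coord (Suc 0) (u, v, w) = u" "coord 2 (u, v, w) = v"
  "coord 3 (u, v, w) = w"
  by (simp_all add: coord_def)

lemma coord_pair_cases:
  fixes i j :: nat
  assumes "i \<in> {1, 2, 3}" "j \<in> {1, 2, 3}" "i \<noteq> j" "coord i t = coord i u" "coord j t = coord j u"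
  shows "coord 1 t = coord 1 u \<and> coord 2 t = coord 2 u \<or> coord 1 t = coord 1 u \<and> coord 3 t = coord 3 u \<or>
    coord 2 t = coord 2 u \<and> coord 3 t = coord 3 u"
  using assms unfolding insert_iff empty_iff by (elim disjE) simp_all

section \<open>Trade and mate from three group elements\<close>

text \<open>Trivial intersections let two coordinates of a triple determine the group element, and
  \<open>xyz\<close> links the shifted symbol of the mate to the trade. Nontriviality makes the
  three subgroups distinct.\<close>

locale coset_bitrade = group +
  fixes x y z
  assumes closed: "x \<in> carrier G" "y \<in> carrier G" "z \<in> carrier G"
    and xyz: "x \<otimes> y \<otimes> z = \<one>"
    and xy: "generate G {x} \<inter> generate G {y} = {\<one>}"
    and xz: "generate G {x} \<inter> generate G {z} = {\<one>}"
    and yz: "generate G {y} \<inter> generate G {z} = {\<one>}"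
    and nontrivial: "x \<noteq> \<one>" "y \<noteq> \<one>"
    and finite_carrier: "finite (carrier G)"
begin

abbreviation X where "X \<equiv> generate G {x}"
abbreviation Y where "Y \<equiv> generate G {y}"
abbreviation Z where "Z \<equiv> generate G {z}"

definition trade_triple where
  "trade_triple g = (g <# X, g <# Y, g <# Z)"

definition mate_triple where
  "mate_triple g = (g <# X, g <# Y, (g \<otimes> inv x) <# Z)"

lemma coset_trade_eq: "coset_trade G x y z = trade_triple ` carrier G"
  by (auto simp: coset_trade_def trade_triple_def)

lemma coset_mate_eq: "coset_mate G x y z = mate_triple ` carrier G"
  by (auto simp: coset_mate_def mate_triple_def)

lemma subgroups: "subgroup X G" "subgroup Y G" "subgroup Z G"
  using closed by (auto intro: generate_is_subgroup)

lemma generators: "x \<in> X" "y \<in> Y" "z \<in> Z"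
  by (auto intro: generate.incl)

lemma inv_generators: "inv x \<in> X" "inv y \<in> Y" "inv z \<in> Z"
  by (auto intro: generate.inv)

lemmas coset_eq_iff =
  l_coset_eq_iff[OF subgroups(1)] l_coset_eq_iff[OF subgroups(2)] l_coset_eq_iff[OF subgroups(3)]

text \<open>Two equal coordinates place \<open>inv g \<otimes> h\<close> in the intersection of two
  of the subgroups, which is trivial.\<close>

lemma trade_determined:
  assumes "g \<in> carrier G" "h \<in> carrier G" "i \<in> {1, 2, 3}" "j \<in> {1, 2, 3}" "i \<noteq> j"
    and "coord i (trade_triple g) = coord i (trade_triple h)"
    and "coord j (trade_triple g) = coord j (trade_triple h)"
  shows "g = h"
proof -
  have coords: "coord 1 (trade_triple g) = coord 1 (trade_triple h) \<longleftrightarrow> inv g \<otimes> h \<in> X"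
    "coord 2 (trade_triple g) = coord 2 (trade_triple h) \<longleftrightarrow> inv g \<otimes> h \<in> Y"
    "coord 3 (trade_triple g) = coord 3 (trade_triple h) \<longleftrightarrow> inv g \<otimes> h \<in> Z"
    using assms(1,2) by (simp_all add: trade_triple_def coset_eq_iff)
  have "inv g \<otimes> h \<in> X \<inter> Y \<or> inv g \<otimes> h \<in> X \<inter> Z \<or> inv g \<otimes> h \<in> Y \<inter> Z"
    using coord_pair_cases[OF assms(3-)] unfolding coords by simp
  then have "inv g \<otimes> h = \<one>" unfolding xy xz yz by simp
  then show ?thesis by (rule inv_mult_eq_one[OF assms(1,2)])
qed

text \<open>With \<open>d = g\<^sup>-\<^sup>1 h\<close>, agreement of the third coordinates of the mate says \<open>x d x\<^sup>-\<^sup>1 \<in> Z\<close>.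
  If \<open>d \<in> X\<close>, this element lies in \<open>X\<close>; if \<open>d \<in> Y\<close>, conjugation by \<open>z\<close> turns it into
  \<open>y\<^sup>-\<^sup>1 d y \<in> Y\<close>, as \<open>z x = y\<^sup>-\<^sup>1\<close>.\<close>

lemma mate_determined:
  assumes g: "g \<in> carrier G" and h: "h \<in> carrier G"
    and ij: "i \<in> {1, 2, 3}" "j \<in> {1, 2, 3}" "i \<noteq> j"
    and "coord i (mate_triple g) = coord i (mate_triple h)"
    and "coord j (mate_triple g) = coord j (mate_triple h)"
  shows "g = h"
proof -
  define d where "d = inv g \<otimes> h"
  have d: "d \<in> carrier G" using g h d_def by simp
  have third: "(g \<otimes> inv x) <# Z = (h \<otimes> inv x) <# Z \<longleftrightarrow> x \<otimes> d \<otimes> inv x \<in> Z"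
    using g h closed by (simp add: coset_eq_iff d_def inv_mult_group m_assoc)
  have coords: "coord 1 (mate_triple g) = coord 1 (mate_triple h) \<longleftrightarrow> d \<in> X"
    "coord 2 (mate_triple g) = coord 2 (mate_triple h) \<longleftrightarrow> d \<in> Y"
    "coord 3 (mate_triple g) = coord 3 (mate_triple h) \<longleftrightarrow> x \<otimes> d \<otimes> inv x \<in> Z"
    using g h third by (simp_all add: mate_triple_def coset_eq_iff d_def)
  have cases: "d \<in> X \<inter> Y \<or> d \<in> X \<and> x \<otimes> d \<otimes> inv x \<in> Z \<or> d \<in> Y \<and> x \<otimes> d \<otimes> inv x \<in> Z"
    using coord_pair_cases[OF assms(3-)] unfolding coords by simp
  have conj_one: "d = \<one>" if "c \<in> carrier G" "c \<otimes> d \<otimes> inv c = \<one>" for c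
  proof -
    have "c \<otimes> d = c" using that d by (simp only: inv_solve_right' m_closed one_closed l_one)
    then show ?thesis using that(1) d by simp
  qed
  have "d = \<one>"
    using cases
  proof (elim disjE conjE)
    assume "d \<in> X \<inter> Y" then show ?thesis unfolding xy by simp
  next
    assume "d \<in> X" "x \<otimes> d \<otimes> inv x \<in> Z"
    moreover then have "x \<otimes> d \<otimes> inv x \<in> X"
      by (intro subgroup.m_closed[OF subgroups(1)] generators inv_generators)
    ultimately have "x \<otimes> d \<otimes> inv x \<in> X \<inter> Z" by simp
    then show ?thesis unfolding xz using conj_one[OF closed(1)] by simp
  next
    assume "d \<in> Y" and Z: "x \<otimes> d \<otimes> inv x \<in> Z"
    then have Y: "inv y \<otimes> d \<otimes> y \<in> Y"
      by (intro subgroup.m_closed[OF subgroups(2)] generators inv_generators)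
    have Z': "z \<otimes> (x \<otimes> d \<otimes> inv x) \<otimes> inv z \<in> Z"
      by (intro subgroup.m_closed[OF subgroups(3)] generators inv_generators Z)
    have "z = inv (inv z)" using closed by simp
    also have "inv z = x \<otimes> y" using inv_equality[OF xyz] closed by simp
    finally have zx: "z \<otimes> x = inv y" using closed by (simp add: inv_mult_group m_assoc)
    have "z \<otimes> (x \<otimes> d \<otimes> inv x) \<otimes> inv z = (z \<otimes> x) \<otimes> d \<otimes> inv (z \<otimes> x)"
      using closed d by (simp add: inv_mult_group m_assoc)
    then have "inv y \<otimes> d \<otimes> inv (inv y) \<in> Y \<inter> Z"
      using Y Z' closed unfolding zx by simp
    then show ?thesis unfolding yz using conj_one[of "inv y"] closed by simp
  qed
  then show ?thesis unfolding d_def by (rule inv_mult_eq_one[OF g h])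
qed

lemma inj_trade_triple: "inj_on trade_triple (carrier G)"
  by (rule inj_onI) (rule trade_determined[where i = 1 and j = 2], auto)

lemma inj_mate_triple: "inj_on mate_triple (carrier G)"
  by (rule inj_onI) (rule mate_determined[where i = 1 and j = 2], auto)

lemma card_coset_trade: "card (coset_trade G x y z) = order G"
  unfolding coset_trade_eq order_def by (rule card_image[OF inj_trade_triple])

lemma card_coset_mate: "card (coset_mate G x y z) = order G"
  unfolding coset_mate_eq order_def by (rule card_image[OF inj_mate_triple])

lemma coset_trade_determined:
  assumes t: "t \<in> coset_trade G x y z" and u: "u \<in> coset_trade G x y z"
    and ij: "i \<in> {1, 2, 3}" "j \<in> {1, 2, 3}" "i \<noteq> j" "coord i t = coord i u" "coord j t = coord j u"
  shows "t = u"
proof -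
  obtain g h where gh: "g \<in> carrier G" "t = trade_triple g" "h \<in> carrier G" "u = trade_triple h"
    using t u unfolding coset_trade_eq by blast
  then have "g = h"
    using trade_determined[OF gh(1,3) ij(1-3)] ij(4,5) by blast
  then show ?thesis using gh by simp
qed

lemma coset_mate_determined:
  assumes t: "t \<in> coset_mate G x y z" and u: "u \<in> coset_mate G x y z"
    and ij: "i \<in> {1, 2, 3}" "j \<in> {1, 2, 3}" "i \<noteq> j" "coord i t = coord i u" "coord j t = coord j u"
  shows "t = u"
proof -
  obtain g h where gh: "g \<in> carrier G" "t = mate_triple g" "h \<in> carrier G" "u = mate_triple h"
    using t u unfolding coset_mate_eq by blast
  then have "g = h"
    using mate_determined[OF gh(1,3) ij(1-3)] ij(4,5) by blast
  then show ?thesis using gh by simp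
qed

section \<open>Exchange between trade and mate\<close>

lemma shift_x:
  assumes "g \<in> carrier G"
  shows "(g \<otimes> inv x) <# X = g <# X" "(g \<otimes> x) <# X = g <# X"
proof -
  show "(g \<otimes> x) <# X = g <# X"
    using assms closed inv_generators by (simp add: coset_eq_iff inv_mult_group m_assoc)
  show "(g \<otimes> inv x) <# X = g <# X"
    using assms closed generators by (simp add: coset_eq_iff inv_mult_group m_assoc)
qed

lemma shift_y:
  assumes "g \<in> carrier G"
  shows "(g \<otimes> inv y) <# Y = g <# Y" "(g \<otimes> y) <# Y = g <# Y"
proof -
  show "(g \<otimes> y) <# Y = g <# Y"
    using assms closed inv_generators by (simp add: coset_eq_iff inv_mult_group m_assoc)
  show "(g \<otimes> inv y) <# Y = g <# Y"
    using assms closed generators by (simp add: coset_eq_iff inv_mult_group m_assoc)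
qed

text \<open>Here the relation enters: \<open>inv y \<otimes> inv x\<close> equals z, and the
  representatives \<open>g \<otimes> inv x\<close> and \<open>g \<otimes> y\<close> differ by
  \<open>x \<otimes> y = inv z\<close>.\<close>

lemma shift_z:
  assumes "g \<in> carrier G"
  shows "(g \<otimes> inv y \<otimes> inv x) <# Z = g <# Z" "(g \<otimes> inv x) <# Z = (g \<otimes> y) <# Z"
proof -
  have *: "x \<otimes> y = inv z"
    using inv_equality[OF xyz] closed by simp
  show "(g \<otimes> inv y \<otimes> inv x) <# Z = g <# Z"
    using assms closed * inv_generators by (simp add: coset_eq_iff inv_mult_group m_assoc)
  have "inv g \<otimes> (g \<otimes> y) = y"
    using assms closed by (simp flip: m_assoc)
  then show "(g \<otimes> inv x) <# Z = (g \<otimes> y) <# Z"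
    using assms closed * inv_generators by (simp add: coset_eq_iff inv_mult_group m_assoc)
qed

lemma trade_to_mate:
  assumes "g \<in> carrier G" "i \<in> {1, 2, 3}" "j \<in> {1, 2, 3}" "i \<noteq> j"
  shows "\<exists>h\<in>carrier G. coord i (trade_triple g) = coord i (mate_triple h) \<and>
    coord j (trade_triple g) = coord j (mate_triple h)"
proof -
  consider "{i, j} = {1, 2}" | "{i, j} = {1, 3}" | "{i, j} = {2, 3}" using assms by auto
  then show ?thesis
  proof cases
    case 1
    then show ?thesis using assms
      by (intro bexI[of _ g]) (auto simp: trade_triple_def mate_triple_def doubleton_eq_iff)
  next
    case 2
    \<comment> \<open>Multiplying by x keeps the row and undoes the shift of the symbol in the
      mate.\<close>
    then show ?thesis using assms closed
      by (intro bexI[of _ "g \<otimes> x"])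
        (auto simp: trade_triple_def mate_triple_def doubleton_eq_iff shift_x m_assoc)
  next
    case 3
    \<comment> \<open>Multiplying by \<open>inv y\<close> keeps the column; the mate then has the
      symbol g y^-1 x^-1 Z = g z Z = g Z.\<close>
    then show ?thesis using assms closed
      by (intro bexI[of _ "g \<otimes> inv y"])
        (auto simp: trade_triple_def mate_triple_def doubleton_eq_iff shift_y shift_z(1))
  qed
qed

lemma mate_to_trade:
  assumes "g \<in> carrier G" "i \<in> {1, 2, 3}" "j \<in> {1, 2, 3}" "i \<noteq> j"
  shows "\<exists>h\<in>carrier G. coord i (mate_triple g) = coord i (trade_triple h) \<and>
    coord j (mate_triple g) = coord j (trade_triple h)"
proof -
  consider "{i, j} = {1, 2}" | "{i, j} = {1, 3}" | "{i, j} = {2, 3}" using assms by auto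
  then show ?thesis
  proof cases
    case 1
    then show ?thesis using assms
      by (intro bexI[of _ g]) (auto simp: trade_triple_def mate_triple_def doubleton_eq_iff)
  next
    case 2
    then show ?thesis using assms closed
      by (intro bexI[of _ "g \<otimes> inv x"])
        (auto simp: trade_triple_def mate_triple_def doubleton_eq_iff shift_x)
  next
    case 3
    \<comment> \<open>Multiplying by y keeps the column and gives the symbol g y Z = g x^-1
      Z.\<close>
    then show ?thesis using assms closed
      by (intro bexI[of _ "g \<otimes> y"])
        (auto simp: trade_triple_def mate_triple_def doubleton_eq_iff shift_y shift_z)
  qed
qed

section \<open>The coset triples form a bitrade\<close>

text \<open>Equal subgroups with trivial intersection are trivial, but every pair includes X or Y,
  whose generators are not the unit.\<close>

lemma subgroups_distinct: "X \<noteq> Y" "X \<noteq> Z" "Y \<noteq> Z"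
  using xy xz yz generators nontrivial by auto

lemma lcosets_finite: "finite (lcosets H)"
  using finite_carrier by (simp add: LCOSETS_def)

lemma partial_latin_square_trade:
  "partial_latin_square (lcosets X) (lcosets Y) (lcosets Z) (coset_trade G x y z)"
proof (rule partial_latin_squareI)
  show "coset_trade G x y z \<subseteq> (lcosets X) \<times> (lcosets Y) \<times> (lcosets Z)"
    by (auto simp: coset_trade_def LCOSETS_def)
  show "t = u" if "t \<in> coset_trade G x y z" "u \<in> coset_trade G x y z" "i \<in> {1, 2, 3}" "j \<in> {1, 2, 3}"
    "i \<noteq> j" "coord i t = coord i u" "coord j t = coord j u" for t u i j
    using that by (rule coset_trade_determined)
  fix c assume "c \<in> (lcosets X) \<union> (lcosets Y) \<union> (lcosets Z)"
  then obtain g where "g \<in> carrier G" "c = g <# X \<or> c = g <# Y \<or> c = g <# Z"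
    by (auto simp: LCOSETS_def)
  then show "\<exists>t\<in>coset_trade G x y z. \<exists>i\<in>{1, 2, 3}. coord i t = c"
    unfolding coset_trade_eq by (intro bexI[of _ "trade_triple g"]) (auto simp: trade_triple_def)
qed (simp_all add: lcosets_finite lcosets_nonempty lcosets_disjoint subgroups subgroups_distinct)

lemma partial_latin_square_mate:
  "partial_latin_square (lcosets X) (lcosets Y) (lcosets Z) (coset_mate G x y z)"
proof (rule partial_latin_squareI)
  show "coset_mate G x y z \<subseteq> (lcosets X) \<times> (lcosets Y) \<times> (lcosets Z)"
    unfolding coset_mate_eq mate_triple_def LCOSETS_def using closed by fastforce
  show "t = u" if "t \<in> coset_mate G x y z" "u \<in> coset_mate G x y z" "i \<in> {1, 2, 3}" "j \<in> {1, 2, 3}"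
    "i \<noteq> j" "coord i t = coord i u" "coord j t = coord j u" for t u i j
    using that by (rule coset_mate_determined)
  fix c assume "c \<in> (lcosets X) \<union> (lcosets Y) \<union> (lcosets Z)"
  then obtain g where g: "g \<in> carrier G" "c = g <# X \<or> c = g <# Y \<or> c = g <# Z"
    by (auto simp: LCOSETS_def)
  \<comment> \<open>The symbol g Z occurs in the mate triple of g x, where the shift by
    \<open>inv x\<close> cancels x.\<close>
  have coords: "coord 1 (mate_triple g) = g <# X" "coord 2 (mate_triple g) = g <# Y"
    "coord 3 (mate_triple (g \<otimes> x)) = g <# Z"
    using g(1) closed by (simp_all add: mate_triple_def m_assoc)
  have "\<exists>h\<in>carrier G. \<exists>i\<in>{1, 2, 3}. coord i (mate_triple h) = c"
    using g(2)
  proof (elim disjE)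
    assume "c = g <# X"
    then show ?thesis using coords(1) g(1) by (intro bexI[of _ g] bexI[of _ 1]) simp_all
  next
    assume "c = g <# Y"
    then show ?thesis using coords(2) g(1) by (intro bexI[of _ g] bexI[of _ 2]) simp_all
  next
    assume "c = g <# Z"
    then show ?thesis
      using coords(3) g(1) closed by (intro bexI[of _ "g \<otimes> x"] bexI[of _ 3]) simp_all
  qed
  then show "\<exists>t\<in>coset_mate G x y z. \<exists>i\<in>{1, 2, 3}. coord i t = c"
    unfolding coset_mate_eq by simp
qed (simp_all add: lcosets_finite lcosets_nonempty lcosets_disjoint subgroups subgroups_distinct)

text \<open>Equal rows and columns force g = h; then g x^-1 Z = g Z puts x into Z, against the
  trivial intersection with X.\<close>

lemma trade_mate_disjoint: "coset_trade G x y z \<inter> coset_mate G x y z = {}"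
proof -
  have False if g: "g \<in> carrier G" and h: "h \<in> carrier G" and eq: "trade_triple g = mate_triple h" for g h
  proof -
    have "coord 1 (trade_triple g) = coord 1 (trade_triple h)"
      "coord 2 (trade_triple g) = coord 2 (trade_triple h)"
      using eq by (auto simp: trade_triple_def mate_triple_def)
    then have "g = h" using trade_determined[of g h 1 2] g h by simp
    then have "(g \<otimes> inv x) <# Z = g <# Z"
      using eq by (simp add: trade_triple_def mate_triple_def)
    then have "x \<in> Z" using g closed by (simp add: coset_eq_iff inv_mult_group m_assoc)
    then show False using xz generators nontrivial by auto
  qed
  then show ?thesis unfolding coset_trade_eq coset_mate_eq by blast
qed

lemma latin_bitrade:
  "latin_bitrade (lcosets X) (lcosets Y) (lcosets Z) (coset_trade G x y z) (coset_mate G x y z)"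
proof (rule latin_bitradeI[OF partial_latin_square_trade partial_latin_square_mate trade_mate_disjoint])
  show "t = u" if "t \<in> coset_trade G x y z" "u \<in> coset_trade G x y z" "i \<in> {1, 2, 3}" "j \<in> {1, 2, 3}"
    "i \<noteq> j" "coord i t = coord i u" "coord j t = coord j u" for t u i j
    using that by (rule coset_trade_determined)
  show "t = u" if "t \<in> coset_mate G x y z" "u \<in> coset_mate G x y z" "i \<in> {1, 2, 3}" "j \<in> {1, 2, 3}"
    "i \<noteq> j" "coord i t = coord i u" "coord j t = coord j u" for t u i j
    using that by (rule coset_mate_determined)
  show "\<exists>u\<in>coset_mate G x y z. coord i t = coord i u \<and> coord j t = coord j u"
    if "t \<in> coset_trade G x y z" "i \<in> {1, 2, 3}" "j \<in> {1, 2, 3}" "i \<noteq> j" for t i j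
    using that trade_to_mate[of _ i j] unfolding coset_trade_eq coset_mate_eq by blast
  show "\<exists>t\<in>coset_trade G x y z. coord i u = coord i t \<and> coord j u = coord j t"
    if "u \<in> coset_mate G x y z" "i \<in> {1, 2, 3}" "j \<in> {1, 2, 3}" "i \<noteq> j" for u i j
    using that mate_to_trade[of _ i j] unfolding coset_trade_eq coset_mate_eq by blast
qed

section \<open>Homogeneity\<close>

text \<open>The triples over a coset c are the images of the elements of c under the injective
  \<open>trade_triple\<close>, and c has as many elements as H. Assumption \<open>i\<close> lets one
  proof serve all three coordinates.\<close>

lemma card_coset_fibre:
  assumes H: "subgroup H G" and c: "c \<in> lcosets H"
    and i: "\<And>g. g \<in> carrier G \<Longrightarrow> coord i (trade_triple g) = g <# H"
  shows "card {t \<in> coset_trade G x y z. coord i t = c} = card H"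
proof -
  have sub: "c \<subseteq> carrier G"
    using subgroup.lcosets_carrier[OF H group_axioms c] .
  obtain g where g: "g \<in> carrier G" "c = g <# H" using c by (auto simp: LCOSETS_def)
  have mem: "h <# H = c \<longleftrightarrow> h \<in> c" if "h \<in> carrier G" for h
    using l_repr_independence[OF _ g(1) H, of h] lcos_self[OF that H] g(2) by auto
  have "{t \<in> coset_trade G x y z. coord i t = c} =
      trade_triple ` {h \<in> carrier G. coord i (trade_triple h) = c}"
    unfolding coset_trade_eq by blast
  also have "{h \<in> carrier G. coord i (trade_triple h) = c} = {h \<in> carrier G. h \<in> c}"
    by (rule Collect_cong) (use i mem in \<open>simp cong: conj_cong\<close>)
  also have "\<dots> = c" using sub by blast
  finally have "card {t \<in> coset_trade G x y z. coord i t = c} = card c"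
    using card_image[OF inj_on_subset[OF inj_trade_triple sub]] by simp
  also have "\<dots> = card H"
    using l_card_cosets_equal[OF c subgroup.subset[OF H] finite_carrier] by simp
  finally show ?thesis .
qed

lemma homogeneous:
  assumes "card X = k" "card Y = k" "card Z = k"
  shows "homogeneous_latin_bitrade k (lcosets X) (lcosets Y) (lcosets Z)
    (coset_trade G x y z) (coset_mate G x y z)"
  unfolding homogeneous_latin_bitrade_def
  using assms latin_bitrade card_coset_fibre[OF subgroups(1), of _ 1]
    card_coset_fibre[OF subgroups(2), of _ 2] card_coset_fibre[OF subgroups(3), of _ 3]
  by (simp add: trade_triple_def)

end


section \<open>The groups of order \<open>p q\<close>\<close>

context group
begin

section \<open>Powers and conjugates\<close>

lemma pow_mod_eq:
  assumes "a \<in> carrier G" "a [^] (p::nat) = \<one>"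
  shows "a [^] (n mod p) = a [^] n"
proof -
  have "a [^] n = a [^] (p * (n div p)) \<otimes> a [^] (n mod p)"
    using assms(1) by (simp add: nat_pow_mult)
  also have "a [^] (p * (n div p)) = \<one>"
    using assms by (simp flip: nat_pow_pow)
  finally show ?thesis using assms(1) by simp
qed

lemma conj_pow:
  assumes "g \<in> carrier G" "x \<in> carrier G"
  shows "(g \<otimes> x \<otimes> inv g) [^] (n::nat) = g \<otimes> x [^] n \<otimes> inv g"
proof (induction n)
  case (Suc n)
  have "inv g \<otimes> (g \<otimes> (x \<otimes> inv g)) = x \<otimes> inv g"
    using assms by (simp flip: m_assoc)
  then show ?case using Suc assms by (simp add: m_assoc)
qed (use assms in simp)

lemma swap_powers:
  assumes a: "a \<in> carrier G" and b: "b \<in> carrier G" and swap: "a \<otimes> b = b \<otimes> a [^] (r::nat)"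
  shows "a [^] (k::nat) \<otimes> b [^] (j::nat) = b [^] j \<otimes> a [^] (k * r ^ j)"
proof -
  have one: "a [^] k \<otimes> b = b \<otimes> a [^] (k * r)" for k :: nat
  proof (induction k)
    case (Suc k)
    have "a [^] Suc k \<otimes> b = (a [^] k \<otimes> b) \<otimes> a [^] r"
      using a b swap by (simp add: m_assoc)
    also have "\<dots> = b \<otimes> a [^] (Suc k * r)"
      using a b Suc by (simp add: m_assoc nat_pow_mult add.commute)
    finally show ?case .
  qed (use b in simp)
  show ?thesis
  proof (induction j)
    case (Suc j)
    have "a [^] k \<otimes> b [^] Suc j = b [^] j \<otimes> (a [^] (k * r ^ j) \<otimes> b)"
      using a b Suc by (simp flip: m_assoc)
    also have "\<dots> = b [^] Suc j \<otimes> a [^] (k * r ^ Suc j)"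
      unfolding one using a b by (simp add: m_assoc mult_ac)
    finally show ?case .
  qed (use a in simp)
qed

text \<open>\<open>b\<^sup>j a\<^sup>i\<close> is the conjugate of \<open>b\<^sup>j\<close> by \<open>a\<^sup>k\<close>, where \<open>(r\<^sup>j - 1) k \<equiv> i\<close> modulo \<open>p\<close>.\<close>

lemma normal_form_pow_eq_one:
  fixes p q r i j :: nat
  assumes a: "a \<in> carrier G" and b: "b \<in> carrier G"
    and "a [^] p = \<one>" "b [^] q = \<one>" and swap: "a \<otimes> b = b \<otimes> a [^] r"
    and p: "prime p" and r: "r > 0" and rj: "[r ^ j \<noteq> 1] (mod p)"
  shows "(b [^] j \<otimes> a [^] i) [^] q = \<one>"
proof -
  have "\<not> p dvd r ^ j - 1"
    using rj r cong_altdef_nat[of 1 "r ^ j" p] by simp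
  then have "coprime (r ^ j - 1) p"
    using p by (simp add: prime_imp_coprime coprime_commute)
  then obtain m where "[(r ^ j - 1) * m = 1] (mod p)"
    using cong_solve_coprime_nat by auto
  then have "[(r ^ j - 1) * m * i = 1 * i] (mod p)"
    by (rule cong_scalar_right)
  \<comment> \<open>The exponent sought is k = m * i. Adding it to both sides turns (r^j - 1) k into
    k r^j, free of truncated subtraction.\<close>
  then have "[(r ^ j - 1) * (m * i) + m * i = i + m * i] (mod p)"
    by (intro cong_add cong_refl) (simp add: mult.assoc)
  moreover have "(r ^ j - 1) * (m * i) + m * i = m * i * r ^ j"
    using r by (cases "r ^ j") (auto simp: algebra_simps)
  ultimately obtain k where k: "[k * r ^ j = i + k] (mod p)" by metis
  then have "a [^] (k * r ^ j) = a [^] (i + k)"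
    using pow_mod_eq[OF a assms(3)] unfolding cong_def by metis
  then have "a [^] k \<otimes> b [^] j = (b [^] j \<otimes> a [^] i) \<otimes> a [^] k"
    using a b by (simp add: swap_powers[OF a b swap] m_assoc nat_pow_mult)
  then have "b [^] j \<otimes> a [^] i = a [^] k \<otimes> b [^] j \<otimes> inv (a [^] k)"
    using a b by (simp add: inv_solve_right)
  then have "(b [^] j \<otimes> a [^] i) [^] q = a [^] k \<otimes> (b [^] j) [^] q \<otimes> inv (a [^] k)"
    using a b by (simp add: conj_pow)
  also have "(b [^] j) [^] q = (b [^] q) [^] j"
    using b by (simp add: nat_pow_pow mult.commute)
  finally show ?thesis using a assms(4) by simp
qed

section \<open>Subgroups of prime order\<close>

text \<open>The order of x divides the prime q and is not 1.\<close>

lemma card_generate_prime: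
  assumes "x \<in> carrier G" "prime (q::nat)" "x [^] q = \<one>" "x \<noteq> \<one>"
  shows "card (generate G {x}) = q"
  using assms pow_eq_id[of x q] ord_eq_1[of x] generate_pow_card[of x] prime_nat_iff by metis

text \<open>A common element w other than the unit generates both subgroups, since all three have q
  elements. Then u is a power of v and commutes with it.\<close>

lemma generate_prime_Int_trivial:
  assumes q: "prime (q::nat)" and u: "u \<in> carrier G" "u [^] q = \<one>" and v: "v \<in> carrier G" "v [^] q = \<one>"
    and uv: "u \<otimes> v \<noteq> v \<otimes> u"
  shows "generate G {u} \<inter> generate G {v} = {\<one>}"
proof (rule ccontr)
  assume "generate G {u} \<inter> generate G {v} \<noteq> {\<one>}"
  then obtain w where w: "w \<in> generate G {u}" "w \<in> generate G {v}" "w \<noteq> \<one>"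
    using generate.one by blast
  have w_closed: "w \<in> carrier G" using w(1) u generate_in_carrier by blast
  have ne: "u \<noteq> \<one>" "v \<noteq> \<one>" using uv u v by auto
  note card = card_generate_prime[OF _ q]
  have ord0: "ord u \<noteq> 0" "ord v \<noteq> 0"
    using card[OF u ne(1)] card[OF v ne(2)] generate_pow_card u v q by auto
  obtain k :: nat where "w = u [^] k"
    using w(1) generate_pow_nat[OF u(1) ord0(1)] by auto
  then have "w [^] q = (u [^] q) [^] k"
    using u(1) by (simp add: nat_pow_pow mult.commute)
  then have "card (generate G {w}) = q"
    using u(2) by (intro card w_closed w(3)) simp
  moreover have "generate G {w} \<subseteq> generate G {u}" "generate G {w} \<subseteq> generate G {v}"
    by (rule generate_subgroup_incl[OF _ generate_is_subgroup]; use w u v in simp)+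
  moreover have "finite (generate G {u})" "finite (generate G {v})"
    using card[OF u ne(1)] card[OF v ne(2)] q by (auto intro: card_ge_0_finite simp: prime_gt_0_nat)
  ultimately have "generate G {w} = generate G {u}" "generate G {w} = generate G {v}"
    using card[OF u ne(1)] card[OF v ne(2)] by (metis card_subset_eq)+
  then have "u \<in> generate G {v}" using generate.incl[of u "{u}"] by auto
  then obtain m :: nat where "u = v [^] m"
    using generate_pow_nat[OF v(1) ord0(2)] by auto
  then show False using uv nat_pow_Suc2[OF v(1), of m] by simp
qed

text \<open>Serves to replace \<open>\<gamma>\<close> by its inverse
  \<open>b \<otimes> \<beta>\<close> when commutation is refuted.\<close>

lemma commute_inv:
  assumes "u \<in> carrier G" "v \<in> carrier G" "u \<otimes> inv v = inv v \<otimes> u"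
  shows "u \<otimes> v = v \<otimes> u"
proof -
  have "u = inv v \<otimes> u \<otimes> v"
    using assms inv_solve_right'[of "inv v \<otimes> u" u v] by simp
  then show ?thesis
    using assms(1,2) inv_solve_left[of u v "u \<otimes> v"] by (simp add: m_assoc)
qed

end

text \<open>For q = 2 m + 1 the power r^q is (r^2)^m r, which is congruent to r.\<close>

lemma square_root_of_unity_mod:
  fixes r q p :: nat
  assumes "odd q" "[r ^ q = 1] (mod p)" "[r ^ 2 = 1] (mod p)"
  shows "[r = 1] (mod p)"
proof -
  obtain m where m: "q = 2 * m + 1" using assms(1) by (elim oddE)
  have "[(r ^ 2) ^ m * r = 1 ^ m * r] (mod p)"
    by (intro cong_mult cong_pow assms(3) cong_refl)
  moreover have "(r ^ 2) ^ m * r = r ^ q" by (simp add: m power_mult)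
  ultimately show ?thesis using assms(2) by (metis cong_sym cong_trans mult_1 power_one)
qed

section \<open>The bitrade of a presented group\<close>

theorem pq_group_bitrade:
  fixes G (structure)
  assumes "prime p" "prime q" "q > 2" "r \<in> {2..p - 1}" "[r ^ q = 1] (mod p)" "pq_group G a b p q r"
  defines "\<beta> \<equiv> a \<otimes> b" and "\<gamma> \<equiv> inv b \<otimes> inv a \<otimes> inv b"
  shows "order G = p * q" "\<not> comm_group G" "b \<otimes> \<beta> \<otimes> \<gamma> = \<one>"
    "generate G {b} \<inter> generate G {\<beta>} = {\<one>}"
    "generate G {b} \<inter> generate G {\<gamma>} = {\<one>}"
    "generate G {\<beta>} \<inter> generate G {\<gamma>} = {\<one>}"
    "generate G {b, \<beta>, \<gamma>} = carrier G"
    "homogeneous_latin_bitrade q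
      (lcosets generate G {b}) (lcosets generate G {\<beta>}) (lcosets generate G {\<gamma>})
      (coset_trade G b \<beta> \<gamma>) (coset_mate G b \<beta> \<gamma>)"
    "card (coset_trade G b \<beta> \<gamma>) = p * q" "card (coset_mate G b \<beta> \<gamma>) = p * q"
proof -
  interpret pq_params p q r
    using assms(1,2,5) prime_gt_1_nat by unfold_locales auto
  note struct = pq_group_structure[OF assms(6)]
  interpret group G by (rule struct)
  have r1: "[r \<noteq> 1] (mod p)" using assms(4) by (auto simp: cong_def)
  then have r2: "[r ^ 2 \<noteq> 1] (mod p)"
    using square_root_of_unity_mod[of q r p] assms(2,3,5) prime_odd_nat by blast
  note a = struct(2) and b = struct(3) and swap = struct(7) and nc = struct(9)[OF r1]
  have \<beta>: "\<beta> \<in> carrier G" and \<gamma>: "\<gamma> \<in> carrier G" using a b by (auto simp: \<beta>_def \<gamma>_def)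
  have \<gamma>_eq: "\<gamma> = inv (b \<otimes> \<beta>)" using a b by (simp add: \<beta>_def \<gamma>_def inv_mult_group m_assoc)
  show order: "order G = p * q" by (rule struct)
  show "\<not> comm_group G"
    using nc a b comm_groupE(4) by metis
  show one: "b \<otimes> \<beta> \<otimes> \<gamma> = \<one>" using b \<beta> by (simp add: \<gamma>_eq)
  \<comment> \<open>Commutation would read b a b = a b b, and cancelling b on the right gives b a =
    a b.\<close>
  have b\<beta>: "b \<otimes> \<beta> \<noteq> \<beta> \<otimes> b"
    using nc a b by (simp add: \<beta>_def flip: m_assoc)
  \<comment> \<open>An element commuting with \<open>\<gamma>\<close> commutes with
    \<open>b \<otimes> \<beta>\<close>. For b, cancelling b on the left, and for
    \<open>\<beta>\<close>, cancelling \<open>\<beta>\<close> on the right, leads back to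
    commutation of b and \<open>\<beta>\<close>.\<close>
  have b\<gamma>: "b \<otimes> \<gamma> \<noteq> \<gamma> \<otimes> b"
  proof
    assume "b \<otimes> \<gamma> = \<gamma> \<otimes> b"
    then have "b \<otimes> (b \<otimes> \<beta>) = (b \<otimes> \<beta>) \<otimes> b"
      unfolding \<gamma>_eq by (rule commute_inv[OF b m_closed[OF b \<beta>]])
    then have "b \<otimes> (b \<otimes> \<beta>) = b \<otimes> (\<beta> \<otimes> b)"
      unfolding m_assoc[OF b \<beta> b] .
    then show False using b\<beta> b \<beta> by simp
  qed
  have \<beta>\<gamma>: "\<beta> \<otimes> \<gamma> \<noteq> \<gamma> \<otimes> \<beta>"
  proof
    assume "\<beta> \<otimes> \<gamma> = \<gamma> \<otimes> \<beta>"
    then have "\<beta> \<otimes> (b \<otimes> \<beta>) = (b \<otimes> \<beta>) \<otimes> \<beta>"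
      unfolding \<gamma>_eq by (rule commute_inv[OF \<beta> m_closed[OF b \<beta>]])
    then have "(\<beta> \<otimes> b) \<otimes> \<beta> = (b \<otimes> \<beta>) \<otimes> \<beta>"
      unfolding m_assoc[OF \<beta> b \<beta>] .
    then show False using b\<beta> b \<beta> by simp
  qed
  \<comment> \<open>Both \<open>\<beta> = b \<otimes> a [^] r\<close> and
    \<open>b \<otimes> \<beta> = b [^] 2 \<otimes> a [^] r\<close> have this shape, with j = 1 and j
    = 2.\<close>
  have pow: "(b [^] j \<otimes> a [^] r) [^] q = \<one>" if "[r ^ j \<noteq> 1] (mod p)" for j :: nat
    using assms(4) by (intro normal_form_pow_eq_one[OF a b struct(5,6) swap assms(1) _ that]) simp
  have bq: "b [^] q = \<one>" by (rule struct)
  have \<beta>q: "\<beta> [^] q = \<one>"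
    using pow[of 1] r1 b swap by (simp add: \<beta>_def)
  have "(b \<otimes> \<beta>) [^] q = \<one>"
    using pow[of 2] r2 a b swap by (simp add: \<beta>_def numeral_2_eq_2 m_assoc)
  then have \<gamma>q: "\<gamma> [^] q = \<one>"
    using b \<beta> by (simp add: \<gamma>_eq nat_pow_inv)
  show b\<beta>1: "generate G {b} \<inter> generate G {\<beta>} = {\<one>}"
    by (rule generate_prime_Int_trivial[OF assms(2) b bq \<beta> \<beta>q b\<beta>])
  show b\<gamma>1: "generate G {b} \<inter> generate G {\<gamma>} = {\<one>}"
    by (rule generate_prime_Int_trivial[OF assms(2) b bq \<gamma> \<gamma>q b\<gamma>])
  show \<beta>\<gamma>1: "generate G {\<beta>} \<inter> generate G {\<gamma>} = {\<one>}"
    by (rule generate_prime_Int_trivial[OF assms(2) \<beta> \<beta>q \<gamma> \<gamma>q \<beta>\<gamma>])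
  show "generate G {b, \<beta>, \<gamma>} = carrier G"
  proof
    show "generate G {b, \<beta>, \<gamma>} \<subseteq> carrier G" using b \<beta> \<gamma> by (intro generate_incl) simp
    have "\<beta> \<otimes> inv b \<in> generate G {b, \<beta>, \<gamma>}"
      by (intro generate.eng generate.inv generate.incl) simp_all
    moreover have "\<beta> \<otimes> inv b = a" using a b by (simp add: \<beta>_def m_assoc)
    ultimately have "{a, b} \<subseteq> generate G {b, \<beta>, \<gamma>}" by (simp add: generate.incl)
    then have "generate G {a, b} \<subseteq> generate G {b, \<beta>, \<gamma>}"
      by (rule generate_subgroup_incl[OF _ generate_is_subgroup]) (use b \<beta> \<gamma> in simp)
    then show "carrier G \<subseteq> generate G {b, \<beta>, \<gamma>}" unfolding struct(4) .
  qed
  have ne: "b \<noteq> \<one>" "\<beta> \<noteq> \<one>" "\<gamma> \<noteq> \<one>"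
    using b\<beta> b\<gamma> l_one[OF b] r_one[OF b] l_one[OF \<beta>] r_one[OF \<beta>] by metis+
  \<comment> \<open>A positive \<open>order\<close> expresses finiteness of the carrier, which the
    locale requires.\<close>
  have "order G > 0" using order p q by simp
  then interpret coset_bitrade G b \<beta> \<gamma>
    by unfold_locales
      (use b \<beta> \<gamma> one b\<beta>1 b\<gamma>1 \<beta>\<gamma>1 ne order_gt_0_iff_finite in blast)+
  show "homogeneous_latin_bitrade q
      (lcosets generate G {b}) (lcosets generate G {\<beta>}) (lcosets generate G {\<gamma>})
      (coset_trade G b \<beta> \<gamma>) (coset_mate G b \<beta> \<gamma>)"
    by (intro homogeneous card_generate_prime assms(2) b bq \<beta> \<beta>q \<gamma> \<gamma>q ne)
  show "card (coset_trade G b \<beta> \<gamma>) = p * q" "card (coset_mate G b \<beta> \<gamma>) = p * q"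
    unfolding card_coset_trade card_coset_mate by (rule order)+
qed

text \<open>The root is g^((p-1)/q) for a primitive root g modulo p.\<close>

lemma exists_root_of_unity_mod:
  fixes p q :: nat
  assumes "prime p" "q > 1" "q dvd p - 1"
  shows "\<exists>r\<in>{2..p - 1}. [r ^ q = 1] (mod p)"
proof -
  obtain g where g: "residue_primroot p g"
    using prime_primitive_root_exists[of p] assms(1) prime_gt_1_nat by blast
  have p: "p > 1" using assms(1) prime_gt_1_nat by blast
  have ord: "Pocklington.ord p g = p - 1"
    using g assms(1) by (auto simp: residue_primroot_def totient_prime)
  obtain k where k: "p - 1 = q * k" using assms(3) by (elim dvdE)
  then have "0 < k" "k < p - 1" using p assms(2) by (auto intro!: Nat.gr0I)
  define r where "r = g ^ k mod p"
  have "[r ^ q = (g ^ k) ^ q] (mod p)" unfolding r_def by (intro cong_pow) simp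
  moreover have "(g ^ k) ^ q = g ^ (p - 1)" unfolding k by (simp add: mult.commute flip: power_mult)
  moreover have "[g ^ (p - 1) = 1] (mod p)" using ord_works[of g p] ord by metis
  ultimately have rq: "[r ^ q = 1] (mod p)" by (metis cong_trans)
  have "r \<noteq> 0"
  proof
    assume "r = 0"
    then show False using rq p assms(2) by (simp add: cong_def zero_power)
  qed
  \<comment> \<open>Here g has order p - 1, which cannot divide k because 0 < k < p - 1.\<close>
  moreover have "r \<noteq> 1"
  proof
    assume "r = 1"
    then have "[g ^ k = 1] (mod p)" using p by (simp add: r_def cong_def)
    then have "p - 1 dvd k" using ord ord_divides by metis
    then show False using \<open>0 < k\<close> \<open>k < p - 1\<close> by (auto dest: dvd_imp_le)
  qed
  moreover have "r < p" using p by (simp add: r_def)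
  ultimately show ?thesis using rq by (intro bexI[of _ r]) auto
qed

text \<open>The first conjunct speaks of any group with the presentation and so asserts no existence
  by itself; the second exhibits such a group on pairs of naturals.\<close>

theorem theorem4p10:
  shows
    "(\<forall>(p::nat) (q::nat) (r::nat) (G :: 'g monoid) a b \<alpha> \<beta> \<gamma>.
        prime p \<and> prime q \<and> p > q \<and> q > 2 \<and> q dvd p - 1 \<and>
        r \<in> {2..p - 1} \<and> [r ^ q = 1] (mod p) \<and>
        pq_group G a b p q r \<and>
        \<alpha> = b \<and> \<beta> = a \<otimes>\<^bsub>G\<^esub> b \<and>
        \<gamma> = inv\<^bsub>G\<^esub> b \<otimes>\<^bsub>G\<^esub> inv\<^bsub>G\<^esub> a \<otimes>\<^bsub>G\<^esub> inv\<^bsub>G\<^esub> b \<longrightarrow>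
        order G = p * q \<and> \<not> comm_group G \<and>
        \<alpha> \<otimes>\<^bsub>G\<^esub> \<beta> \<otimes>\<^bsub>G\<^esub> \<gamma> = \<one>\<^bsub>G\<^esub> \<and>
        generate G {\<alpha>} \<inter> generate G {\<beta>} = {\<one>\<^bsub>G\<^esub>} \<and>
        generate G {\<alpha>} \<inter> generate G {\<gamma>} = {\<one>\<^bsub>G\<^esub>} \<and>
        generate G {\<beta>} \<inter> generate G {\<gamma>} = {\<one>\<^bsub>G\<^esub>} \<and>
        generate G {\<alpha>, \<beta>, \<gamma>} = carrier G \<and>
        homogeneous_latin_bitrade q
          (lcosets\<^bsub>G\<^esub> generate G {\<alpha>}) (lcosets\<^bsub>G\<^esub> generate G {\<beta>}) (lcosets\<^bsub>G\<^esub> generate G {\<gamma>})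
          (coset_trade G \<alpha> \<beta> \<gamma>) (coset_mate G \<alpha> \<beta> \<gamma>) \<and>
        card (coset_trade G \<alpha> \<beta> \<gamma>) = p * q \<and> card (coset_mate G \<alpha> \<beta> \<gamma>) = p * q)
     \<and>
     (\<forall>(p::nat) (q::nat).
        prime p \<and> prime q \<and> q > 2 \<and> q dvd p - 1 \<longrightarrow>
        (\<exists>r (G :: (nat \<times> nat) monoid) a b \<alpha> \<beta> \<gamma>.
           r \<in> {2..p - 1} \<and> [r ^ q = 1] (mod p) \<and>
           pq_group G a b p q r \<and>
           \<alpha> = b \<and> \<beta> = a \<otimes>\<^bsub>G\<^esub> b \<and>
           \<gamma> = inv\<^bsub>G\<^esub> b \<otimes>\<^bsub>G\<^esub> inv\<^bsub>G\<^esub> a \<otimes>\<^bsub>G\<^esub> inv\<^bsub>G\<^esub> b \<and>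
           homogeneous_latin_bitrade q
             (lcosets\<^bsub>G\<^esub> generate G {\<alpha>}) (lcosets\<^bsub>G\<^esub> generate G {\<beta>}) (lcosets\<^bsub>G\<^esub> generate G {\<gamma>})
             (coset_trade G \<alpha> \<beta> \<gamma>) (coset_mate G \<alpha> \<beta> \<gamma>) \<and>
           card (coset_trade G \<alpha> \<beta> \<gamma>) = p * q \<and> card (coset_mate G \<alpha> \<beta> \<gamma>) = p * q))"
proof (rule conjI; intro allI impI)
  fix p q r :: nat and G :: "'g monoid" and a b \<alpha> \<beta> \<gamma>
  assume h: "prime p \<and> prime q \<and> p > q \<and> q > 2 \<and> q dvd p - 1 \<and>
    r \<in> {2..p - 1} \<and> [r ^ q = 1] (mod p) \<and> pq_group G a b p q r \<and>
    \<alpha> = b \<and> \<beta> = a \<otimes>\<^bsub>G\<^esub> b \<and>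
    \<gamma> = inv\<^bsub>G\<^esub> b \<otimes>\<^bsub>G\<^esub> inv\<^bsub>G\<^esub> a \<otimes>\<^bsub>G\<^esub> inv\<^bsub>G\<^esub> b"
  then have eqs: "\<alpha> = b" "\<beta> = a \<otimes>\<^bsub>G\<^esub> b"
    "\<gamma> = inv\<^bsub>G\<^esub> b \<otimes>\<^bsub>G\<^esub> inv\<^bsub>G\<^esub> a \<otimes>\<^bsub>G\<^esub> inv\<^bsub>G\<^esub> b"
    by blast+
  show "order G = p * q \<and> \<not> comm_group G \<and>
    \<alpha> \<otimes>\<^bsub>G\<^esub> \<beta> \<otimes>\<^bsub>G\<^esub> \<gamma> = \<one>\<^bsub>G\<^esub> \<and>
    generate G {\<alpha>} \<inter> generate G {\<beta>} = {\<one>\<^bsub>G\<^esub>} \<and>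
    generate G {\<alpha>} \<inter> generate G {\<gamma>} = {\<one>\<^bsub>G\<^esub>} \<and>
    generate G {\<beta>} \<inter> generate G {\<gamma>} = {\<one>\<^bsub>G\<^esub>} \<and>
    generate G {\<alpha>, \<beta>, \<gamma>} = carrier G \<and>
    homogeneous_latin_bitrade q
      (lcosets\<^bsub>G\<^esub> generate G {\<alpha>}) (lcosets\<^bsub>G\<^esub> generate G {\<beta>}) (lcosets\<^bsub>G\<^esub> generate G {\<gamma>})
      (coset_trade G \<alpha> \<beta> \<gamma>) (coset_mate G \<alpha> \<beta> \<gamma>) \<and>
    card (coset_trade G \<alpha> \<beta> \<gamma>) = p * q \<and> card (coset_mate G \<alpha> \<beta> \<gamma>) = p * q"
    unfolding eqs by (intro conjI pq_group_bitrade[of p q r G a b]) (use h in blast)+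
next
  fix p q :: nat
  assume "prime p \<and> prime q \<and> q > 2 \<and> q dvd p - 1"
  then have h: "prime p" "prime q" "q > 2" "q dvd p - 1" by blast+
  then obtain r where root: "r \<in> {2..p - 1}" "[r ^ q = 1] (mod p)"
    using exists_root_of_unity_mod[of p q] by auto
  interpret pq_params p q r
    using h(1,2) root(2) prime_gt_1_nat by unfold_locales auto
  let ?G = "pq_model p q r" and ?a = "(1, 0) :: nat \<times> nat" and ?b = "(0, 1) :: nat \<times> nat"
  note bitrade = pq_group_bitrade[OF h(1-3) root pq_group_model]
  show "\<exists>r (G :: (nat \<times> nat) monoid) a b \<alpha> \<beta> \<gamma>.
    r \<in> {2..p - 1} \<and> [r ^ q = 1] (mod p) \<and>
    pq_group G a b p q r \<and>
    \<alpha> = b \<and> \<beta> = a \<otimes>\<^bsub>G\<^esub> b \<and>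
    \<gamma> = inv\<^bsub>G\<^esub> b \<otimes>\<^bsub>G\<^esub> inv\<^bsub>G\<^esub> a \<otimes>\<^bsub>G\<^esub> inv\<^bsub>G\<^esub> b \<and>
    homogeneous_latin_bitrade q
      (lcosets\<^bsub>G\<^esub> generate G {\<alpha>}) (lcosets\<^bsub>G\<^esub> generate G {\<beta>}) (lcosets\<^bsub>G\<^esub> generate G {\<gamma>})
      (coset_trade G \<alpha> \<beta> \<gamma>) (coset_mate G \<alpha> \<beta> \<gamma>) \<and>
    card (coset_trade G \<alpha> \<beta> \<gamma>) = p * q \<and> card (coset_mate G \<alpha> \<beta> \<gamma>) = p * q"
    \<comment> \<open>The witnesses for \<open>\<alpha>\<close>, \<open>\<beta>\<close> and
      \<open>\<gamma>\<close> stay schematic until \<open>refl\<close> solves their defining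
      equations; \<open>bitrade(8-10)\<close> are homogeneity and the two cardinalities.\<close>
    by (rule exI[of _ r], rule exI[of _ ?G], rule exI[of _ ?a], rule exI[of _ ?b], intro exI conjI)
      (rule root pq_group_model refl bitrade(8-10))+
qed

end
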